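(* The meet-stalactic monoid $\mathbb{N}^*/{\equiv_{\mathrm{mSt}}}$ is presented by $\langle \mathbb{N} \mid \mathcal{R}_{\mathrm{mSt}}\rangle$, where $$\mathcal{R}_{\mathrm{mSt}} = \{ (b\, u\, b a\, v\, b,\; b\, u\, a b\, v\, b) : a,b \in \mathbb{N},\ u,v \in \mathbb{N}^* \} \cup \{ (a\, u\, a b\, v\, b,\; a\, u\, b a\, v\, b) : a,b \in \mathbb{N},\ u,v \in \mathbb{N}^* \}.$$ That is, the congruence $\equiv_{\mathrm{mSt}}$ is the monoid congruence on $\mathbb{N}^*$ generated by $\mathcal{R}_{\mathrm{mSt}}$.
   Context: $\mathbb{N}=\{1,2,\dots\}$ and $\mathbb{N}^*$ is the free monoid of words over $\mathbb{N}$. The right-stalactic congruence $\equiv_{\mathrm{rSt}}$ is the congruence on $\mathbb{N}^*$ generated by the pairs $(ba\,u\,b,\ ab\,u\,b)$ with $a,b\in\mathbb{N}$, $u\in\mathbb{N}^*$; equivalently, two words are $\equiv_{\mathrm{rSt}}$-congruent iff each letter occurs the same number of times in both and the order of the last occurrences of the letters (reading left to right) is the same in both. The left-stalactic congruence $\equiv_{\mathrm{lSt}}$ is the congruence generated by the pairs $(b\,u\,ab,\ b\,u\,ba)$ with $a,b\in\mathbb{N}$, $u\in\mathbb{N}^*$; equivalently, two words are $\equiv_{\mathrm{lSt}}$-congruent iff each letter occurs the same number of times in both and the order of the first occurrences of the letters (reading left to right) is the same in both. The meet-stalactic congruence $\equiv_{\mathrm{mSt}}$ is the meet (intersection) of $\equiv_{\mathrm{rSt}}$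 and $\equiv_{\mathrm{lSt}}$. *)

theory Defs
  imports Main HOL.Hull
begin

(* The paper's natural numbers start at 1; its words are the lists over {1..}. *)
abbreviation alphabet :: "nat set" where
  "alphabet \<equiv> {1..}"

abbreviation words :: "nat list set" where
  "words \<equiv> lists alphabet"

definition monoid_congruence :: "(nat list \<times> nat list) set \<Rightarrow> bool" where
  "monoid_congruence r \<longleftrightarrow>
     equiv words r \<and>
     (\<forall>u v x y. (u, v) \<in> r \<and> (x, y) \<in> r \<longrightarrow> (u @ x, v @ y) \<in> r)"

(* For R \<subseteq> words \<times> words the hull is the least congruence containing R,
   see monoid_congruence_generated below. *)
definition generated_congruence :: "(nat list \<times> nat list) set \<Rightarrow> (nat list \<times> nat list) set" where
  "generated_congruence R = monoid_congruence hull R"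

definition rSt_relations :: "(nat list \<times> nat list) set" where
  "rSt_relations =
     {([b, a] @ u @ [b], [a, b] @ u @ [b]) | a b u.
        a \<in> alphabet \<and> b \<in> alphabet \<and> u \<in> words}"

definition lSt_relations :: "(nat list \<times> nat list) set" where
  "lSt_relations =
     {([b] @ u @ [a, b], [b] @ u @ [b, a]) | a b u.
        a \<in> alphabet \<and> b \<in> alphabet \<and> u \<in> words}"

definition right_stalactic :: "(nat list \<times> nat list) set" where
  "right_stalactic = generated_congruence rSt_relations"

definition left_stalactic :: "(nat list \<times> nat list) set" where
  "left_stalactic = generated_congruence lSt_relations"

definition meet_stalactic :: "(nat list \<times> nat list) set" where
  "meet_stalactic = right_stalactic \<inter> left_stalactic"

definition mSt_relations :: "(nat list \<times> nat list) set" where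
  "mSt_relations =
     {([b] @ u @ [b, a] @ v @ [b], [b] @ u @ [a, b] @ v @ [b]) | a b u v.
        a \<in> alphabet \<and> b \<in> alphabet \<and> u \<in> words \<and> v \<in> words} \<union>
     {([a] @ u @ [a, b] @ v @ [b], [a] @ u @ [b, a] @ v @ [b]) | a b u v.
        a \<in> alphabet \<and> b \<in> alphabet \<and> u \<in> words \<and> v \<in> words}"

lemma monoid_congruence_generated:
  assumes "R \<subseteq> words \<times> words"
  shows "monoid_congruence (generated_congruence R)"
proof -
  define C where "C = {r. monoid_congruence r \<and> R \<subseteq> r}"
  have hull: "generated_congruence R = \<Inter>C"
    unfolding C_def generated_congruence_def hull_def ..
  have "monoid_congruence (words \<times> words)"
    unfolding monoid_congruence_def equiv_def
    by (simp add: refl_on_def sym_def trans_def)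
  then have top: "words \<times> words \<in> C"
    using assms by (simp add: C_def)
  have equiv: "equiv words r" if "r \<in> C" for r
    using that by (simp add: C_def monoid_congruence_def)
  have "\<Inter>C \<subseteq> words \<times> words"
    using top by (rule Inter_lower)
  moreover have "refl_on words (\<Inter>C)"
  proof (rule refl_onI)
    fix w assume "w \<in> words"
    then show "(w, w) \<in> \<Inter>C"
      using equiv by (intro InterI) (simp add: equiv_def refl_on_def)
  qed
  moreover have "sym (\<Inter>C)"
    using equiv by (intro symI InterI) (meson InterD equiv_def symE)
  moreover have "trans (\<Inter>C)"
    using equiv by (intro transI InterI) (meson InterD equiv_def transE)
  moreover have "(u @ x, v @ y) \<in> \<Inter>C"
    if uv: "(u, v) \<in> \<Inter>C" and xy: "(x, y) \<in> \<Inter>C" for u v x y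
  proof (rule InterI)
    fix r assume r: "r \<in> C"
    have "(u, v) \<in> r" "(x, y) \<in> r"
      using InterD[OF uv r] InterD[OF xy r] .
    with r show "(u @ x, v @ y) \<in> r"
      by (simp add: C_def monoid_congruence_def)
  qed
  ultimately show ?thesis
    unfolding hull monoid_congruence_def equiv_def by simp
qed

end

theory Submission
  imports Defs "HOL-Library.Multiset"
begin

text \<open>
  Read in a context \<open>p _ s\<close>, the relations of \<open>mSt_relations\<close> allow two adjacent
  letters to be swapped exactly when one of them occurs in \<open>p\<close> and one of them occurs in \<open>s\<close>,
  that is, unless both are first occurrences or both are last occurrences. Two words with the same
  content and the same orders of first and last occurrences are therefore connected by a bubble sort
  that builds the target word letter by letter from the left: every inversion that has to be undone
  is such a swap.
\<close>

section \<open>Generated congruences, and how \<open>remdups\<close> acts on concatenations\<close>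

lemma monoid_congruenceD:
  assumes "monoid_congruence r"
  shows monoid_congruence_refl: "w \<in> words \<Longrightarrow> (w, w) \<in> r"
    and monoid_congruence_sym: "(u, v) \<in> r \<Longrightarrow> (v, u) \<in> r"
    and monoid_congruence_trans: "(u, v) \<in> r \<Longrightarrow> (v, w) \<in> r \<Longrightarrow> (u, w) \<in> r"
    and monoid_congruence_append: "(u, v) \<in> r \<Longrightarrow> (x, y) \<in> r \<Longrightarrow> (u @ x, v @ y) \<in> r"
proof -
  have r: "refl_on words r" "sym r" "trans r"
    using assms by (simp_all add: monoid_congruence_def equiv_def)
  show "w \<in> words \<Longrightarrow> (w, w) \<in> r"
    using r(1) by (rule refl_onD)
  show "(u, v) \<in> r \<Longrightarrow> (v, u) \<in> r"
    using r(2) by (rule symD)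
  show "(u, v) \<in> r \<Longrightarrow> (v, w) \<in> r \<Longrightarrow> (u, w) \<in> r"
    using r(3) by (rule transD)
  show "(u, v) \<in> r \<Longrightarrow> (x, y) \<in> r \<Longrightarrow> (u @ x, v @ y) \<in> r"
    using assms by (simp add: monoid_congruence_def)
qed

lemma monoid_congruence_context:
  assumes "monoid_congruence r" "(u, v) \<in> r" "p \<in> words" "s \<in> words"
  shows "(p @ u @ s, p @ v @ s) \<in> r"
  using assms by (intro monoid_congruence_append monoid_congruence_refl)

lemma generated_congruence_least:
  "R \<subseteq> r \<Longrightarrow> monoid_congruence r \<Longrightarrow> generated_congruence R \<subseteq> r"
  unfolding generated_congruence_def by (rule hull_minimal)

lemma generated_congruence_superset: "R \<subseteq> generated_congruence R"
  unfolding generated_congruence_def by (rule hull_subset)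

lemma rSt_relations_words: "rSt_relations \<subseteq> words \<times> words"
  and lSt_relations_words: "lSt_relations \<subseteq> words \<times> words"
  and mSt_relations_words: "mSt_relations \<subseteq> words \<times> words"
  unfolding rSt_relations_def lSt_relations_def mSt_relations_def by auto

lemmas monoid_congruence_right_stalactic =
  monoid_congruence_generated[OF rSt_relations_words, folded right_stalactic_def]

lemmas monoid_congruence_left_stalactic =
  monoid_congruence_generated[OF lSt_relations_words, folded left_stalactic_def]

text \<open>The library's \<open>remdups\<close> keeps the last occurrence of every element.\<close>

lemma remdups_append_filter:
  "remdups (u @ v) = filter (\<lambda>x. x \<notin> set v) (remdups u) @ remdups v"
  by (induction u) auto

lemma remdups_append_cong:
  assumes "remdups u = remdups v" "remdups x = remdups y"
  shows "remdups (u @ x) = remdups (v @ y)"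
proof -
  have "set x = set y"
    using assms(2) by (metis set_remdups)
  then show ?thesis
    using assms by (simp add: remdups_append_filter)
qed

lemma remdups_absorb: "set u \<subseteq> set v \<Longrightarrow> remdups (u @ v) = remdups v"
  by (induction u) auto

text \<open>If \<open>x\<close> recurs in \<open>s\<close>, its displayed copy is not a last
  occurrence; if all letters of \<open>q\<close> recur in \<open>s\<close>, none inside
  \<open>q\<close> is. Either way no two last occurrences are exchanged.\<close>

lemma remdups_move_front:
  assumes "x \<in> set s \<or> set q \<subseteq> set s"
  shows "remdups (q @ x # s) = remdups (x # q @ s)"
proof (cases "x \<in> set s")
  case True
  then show ?thesis
    by (simp add: remdups_append_filter insert_absorb)
next
  case False
  then have "set q \<subseteq> set s" "x \<notin> set q"
    using assms by auto
  then show ?thesis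
    using False by (simp add: remdups_absorb remdups_absorb[of q "x # s", simplified] subset_insertI2)
qed

text \<open>The displayed \<open>x\<close> is a last occurrence in both words, so it appears exactly
  once in each \<open>remdups\<close>, and the two equal lists split there.\<close>

lemma remdups_eq_suffix:
  assumes eq: "remdups (a @ x # c) = remdups (b @ x # d)" and "x \<notin> set c" "x \<notin> set d"
  shows "remdups c = remdups d"
proof -
  define A where "A = filter (\<lambda>y. y \<notin> set (x # c)) (remdups a)"
  define B where "B = filter (\<lambda>y. y \<notin> set (x # d)) (remdups b)"
  have "A @ x # remdups c = B @ x # remdups d"
    using assms remdups_append_filter[of a "x # c"] remdups_append_filter[of b "x # d"]
    unfolding A_def B_def by simp
  moreover have "x \<notin> set A" "x \<notin> set B"
    by (simp_all add: A_def B_def)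
  ultimately show ?thesis
    using assms(2,3) by (metis append_Cons_eq_iff set_remdups)
qed

section \<open>Invariants: content and order of last or first occurrences\<close>

definition same_last_order :: "(nat list \<times> nat list) set" where
  "same_last_order =
     {(u, v). u \<in> words \<and> v \<in> words \<and> mset u = mset v \<and> remdups u = remdups v}"

text \<open>Reversal turns first occurrences into last ones, so the facts about
  \<open>remdups\<close> serve both orders.\<close>

definition same_first_order :: "(nat list \<times> nat list) set" where
  "same_first_order = {(u, v). (rev u, rev v) \<in> same_last_order}"

lemma monoid_congruence_same_last_order: "monoid_congruence same_last_order"
  unfolding monoid_congruence_def equiv_def same_last_order_def
  by (auto simp: refl_on_def sym_def trans_def intro: remdups_append_cong)

lemma monoid_congruence_same_first_order: "monoid_congruence same_first_order"
  unfolding monoid_congruence_def equiv_def same_first_order_def same_last_order_def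
  by (auto simp: refl_on_def sym_def trans_def intro: remdups_append_cong)

lemma right_stalactic_same_last_order: "right_stalactic \<subseteq> same_last_order"
  unfolding right_stalactic_def
proof (rule generated_congruence_least[OF _ monoid_congruence_same_last_order])
  show "rSt_relations \<subseteq> same_last_order"
    unfolding rSt_relations_def same_last_order_def by auto
qed

lemma left_stalactic_same_first_order: "left_stalactic \<subseteq> same_first_order"
  unfolding left_stalactic_def
proof (rule generated_congruence_least[OF _ monoid_congruence_same_first_order])
  show "lSt_relations \<subseteq> same_first_order"
    unfolding lSt_relations_def same_first_order_def same_last_order_def by auto
qed

section \<open>Soundness: the relations hold in both stalactic congruences\<close>

lemma mSt_relations_subset_right_stalactic: "mSt_relations \<subseteq> right_stalactic"
proof -
  have rel: "([b, a] @ v @ [b], [a, b] @ v @ [b]) \<in> right_stalactic"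
    if "a \<in> alphabet" "b \<in> alphabet" "v \<in> words" for a b v
    using that generated_congruence_superset[of rSt_relations]
    unfolding right_stalactic_def rSt_relations_def by blast
  note cong = monoid_congruence_right_stalactic
  \<comment> \<open>Both families end in \<open>b\<close>, so the swap happens before a later
    \<open>b\<close>; the second family uses \<open>rel\<close> backwards.\<close>
  have "([b] @ u @ [b, a] @ v @ [b], [b] @ u @ [a, b] @ v @ [b]) \<in> right_stalactic"
    if "a \<in> alphabet" "b \<in> alphabet" "u \<in> words" "v \<in> words" for a b u v
    using monoid_congruence_context[OF cong rel[of a b v], of "[b] @ u" "[]"] that by simp
  moreover have "([a] @ u @ [a, b] @ v @ [b], [a] @ u @ [b, a] @ v @ [b]) \<in> right_stalactic"
    if "a \<in> alphabet" "b \<in> alphabet" "u \<in> words" "v \<in> words" for a b u v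
    using monoid_congruence_context[OF cong monoid_congruence_sym[OF cong rel[of a b v]],
        of "[a] @ u" "[]"] that by simp
  ultimately show ?thesis
    unfolding mSt_relations_def by blast
qed

lemma mSt_relations_subset_left_stalactic: "mSt_relations \<subseteq> left_stalactic"
proof -
  have rel: "([b] @ u @ [a, b], [b] @ u @ [b, a]) \<in> left_stalactic"
    if "a \<in> alphabet" "b \<in> alphabet" "u \<in> words" for a b u
    using that generated_congruence_superset[of lSt_relations]
    unfolding left_stalactic_def lSt_relations_def by blast
  note cong = monoid_congruence_left_stalactic
  \<comment> \<open>The free last letter \<open>c\<close> covers both families: it is the leading
    letter in the first and the other swapped letter in the second.\<close>
  have "([b] @ u @ [b, a] @ v @ [c], [b] @ u @ [a, b] @ v @ [c]) \<in> left_stalactic"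
    if "a \<in> alphabet" "b \<in> alphabet" "c \<in> alphabet" "u \<in> words" "v \<in> words" for a b c u v
    using monoid_congruence_context[OF cong monoid_congruence_sym[OF cong rel[of a b u]],
        of "[]" "v @ [c]"] that by simp
  then show ?thesis
    unfolding mSt_relations_def by blast
qed

section \<open>Completeness: sorting by permitted swaps\<close>

context
  fixes r :: "(nat list \<times> nat list) set"
  assumes cong: "monoid_congruence r" and mSt: "mSt_relations \<subseteq> r"
begin

text \<open>The segment from a letter of the pair in \<open>p\<close> to one in \<open>s\<close> is
  a side of a relation: of the first family if these letters agree, of the second if they differ, up
  to renaming and symmetry.\<close>

lemma mSt_swap:
  assumes words: "p \<in> words" "s \<in> words" "x \<in> alphabet" "y \<in> alphabet"
    and before: "x \<in> set p \<or> y \<in> set p" and after: "x \<in> set s \<or> y \<in> set s"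
  shows "(p @ [x, y] @ s, p @ [y, x] @ s) \<in> r"
proof -
  obtain c where c: "c \<in> {x, y}" "c \<in> set p"
    using before by blast
  obtain d where d: "d \<in> {x, y}" "d \<in> set s"
    using after by blast
  obtain p1 p2 where p: "p = p1 @ c # p2"
    using c(2) by (meson split_list)
  obtain s1 s2 where s: "s = s1 @ d # s2"
    using d(2) by (meson split_list)
  have p2s1: "p2 \<in> words" "s1 \<in> words"
    using words p s by auto
  have rel1: "([b] @ p2 @ [b, a] @ s1 @ [b], [b] @ p2 @ [a, b] @ s1 @ [b]) \<in> r"
    and rel2: "([a] @ p2 @ [a, b] @ s1 @ [b], [a] @ p2 @ [b, a] @ s1 @ [b]) \<in> r"
    if "a \<in> alphabet" "b \<in> alphabet" for a b
    using that p2s1 by (intro subsetD[OF mSt]; unfold mSt_relations_def; blast)+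
  note rels = rel1 rel1[THEN monoid_congruence_sym[OF cong]]
    rel2 rel2[THEN monoid_congruence_sym[OF cong]]
  have "([c] @ p2 @ [x, y] @ s1 @ [d], [c] @ p2 @ [y, x] @ s1 @ [d]) \<in> r"
    using c(1) d(1) rels[OF words(3,4)] rels[OF words(4,3)] by auto
  from monoid_congruence_context[OF cong this, of p1 s2] show ?thesis
    using words by (simp add: p s)
qed

text \<open>\<open>x\<close> passes the letters of \<open>q\<close> from right to left; in
  \<open>p\<close> and in \<open>t\<close>, either \<open>x\<close> or the passed letter occurs, so
  each swap is permitted.\<close>

lemma mSt_move_front:
  assumes "p \<in> words" "q \<in> words" "t \<in> words" "x \<in> alphabet"
    and "x \<in> set p \<or> set q \<subseteq> set p" "x \<in> set t \<or> set q \<subseteq> set t"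
  shows "(p @ q @ x # t, p @ x # q @ t) \<in> r"
  using assms
proof (induction q arbitrary: t rule: rev_induct)
  case Nil
  then show ?case
    by (simp add: monoid_congruence_refl[OF cong])
next
  case (snoc y q)
  have "((p @ q) @ [y, x] @ t, (p @ q) @ [x, y] @ t) \<in> r"
    using snoc.prems by (intro mSt_swap) auto
  moreover have "(p @ q @ x # y # t, p @ x # q @ y # t) \<in> r"
    using snoc.prems by (intro snoc.IH) auto
  ultimately show ?case
    using monoid_congruence_trans[OF cong] by simp
qed

text \<open>\<open>p\<close> is the prefix already built. Whether an occurrence in \<open>w\<close>
  is a first one depends on \<open>p\<close>, whether it is a last one on \<open>w\<close> alone;
  hence the asymmetric hypotheses.\<close>

lemma mSt_complete:
  assumes "p \<in> words" "w \<in> words" "mset w = mset w'"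
    and "remdups (rev (p @ w)) = remdups (rev (p @ w'))" "remdups w = remdups w'"
  shows "(p @ w, p @ w') \<in> r"
  using assms
proof (induction w' arbitrary: p w)
  case Nil
  then show ?case
    by (simp add: monoid_congruence_refl[OF cong])
next
  case (Cons x t')
  note firsts = Cons.prems(4) and lasts = Cons.prems(5)
  have "x \<in> set w"
    using Cons.prems(3) by (metis list.set_intros(1) set_mset_mset)
  then obtain q t where w: "w = q @ x # t" and xq: "x \<notin> set q"
    by (meson split_list_first)
  have words: "q \<in> words" "t \<in> words" "x \<in> alphabet"
    using Cons.prems(2) by (auto simp: w)
  have mset: "mset (q @ t) = mset t'"
    using Cons.prems(3) by (simp add: w)
  then have set: "set q \<union> set t = set t'"
    by (metis set_append set_mset_mset)
  \<comment> \<open>If \<open>x\<close> is new, the target has it right after \<open>p\<close>; so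
    the letters before it in \<open>p @ w\<close>, those of \<open>q\<close> included, already lie
    in \<open>p\<close>.\<close>
  have "set q \<subseteq> set p" if "x \<notin> set p"
  proof -
    have "remdups (rev q @ rev p) = remdups (rev p)"
      by (rule remdups_eq_suffix[of "rev t" x _ "rev t'"])
        (use that firsts xq in \<open>simp_all add: w\<close>)
    then have "set (rev q @ rev p) = set (rev p)"
      by (metis set_remdups)
    then show "set q \<subseteq> set p"
      by auto
  qed
  then have p: "x \<in> set p \<or> set q \<subseteq> set p"
    by blast
  \<comment> \<open>Dually, if no \<open>x\<close> remains in \<open>t\<close>, the same letters
    follow the last \<open>x\<close> in both words, so \<open>t\<close> has all letters of
    \<open>t'\<close>, among them those of \<open>q\<close>.\<close>
  have "set q \<subseteq> set t" if "x \<notin> set t"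
  proof -
    have x_t': "x \<notin> set t'"
      using that set xq by auto
    have "remdups t = remdups t'"
      by (rule remdups_eq_suffix[of q x _ "[]"]) (use that lasts x_t' in \<open>simp_all add: w\<close>)
    then have "set t = set t'"
      by (metis set_remdups)
    then show "set q \<subseteq> set t"
      using set by auto
  qed
  then have t: "x \<in> set t \<or> set q \<subseteq> set t"
    by blast
  \<comment> \<open>Read in reverse, pulling \<open>x\<close> forward keeps the order of first
    occurrences.\<close>
  have "remdups (rev t @ x # rev q @ rev p) = remdups (rev t @ rev q @ x # rev p)"
    by (rule remdups_append_cong) (use remdups_move_front[of x "rev p" "rev q"] p in auto)
  then have "remdups (rev ((p @ [x]) @ q @ t)) = remdups (rev ((p @ [x]) @ t'))"
    using firsts by (simp add: w)
  moreover have "remdups (q @ t) = remdups t'"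
  proof -
    have "remdups (x # q @ t) = remdups (x # t')"
      using lasts remdups_move_front[OF t] by (simp only: w)
    \<comment> \<open>Thus \<open>remdups\<close> keeps or drops the leading \<open>x\<close> on
      both sides alike, and it cancels.\<close>
    moreover have "x \<in> set (q @ t) \<longleftrightarrow> x \<in> set t'"
      using set by auto
    ultimately show ?thesis
      by (simp split: if_splits)
  qed
  ultimately have "((p @ [x]) @ q @ t, (p @ [x]) @ t') \<in> r"
    using Cons.prems(1) words mset by (intro Cons.IH) auto
  with mSt_move_front[OF Cons.prems(1) words p t] show ?case
    using monoid_congruence_trans[OF cong] by (simp add: w)
qed

end

theorem proposition3p1:
  shows "meet_stalactic = generated_congruence mSt_relations"
proof (rule subset_antisym)
  show "meet_stalactic \<subseteq> generated_congruence mSt_relations"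
  proof
    fix z assume z: "z \<in> meet_stalactic"
    obtain u v where uv: "z = (u, v)"
      by (cases z)
    have "(u, v) \<in> same_last_order" "(u, v) \<in> same_first_order"
      using z right_stalactic_same_last_order left_stalactic_same_first_order
      by (auto simp: uv meet_stalactic_def)
    \<comment> \<open>For the empty prefix, the order hypotheses of \<open>mSt_complete\<close> are
      exactly the two invariants.\<close>
    then show "z \<in> generated_congruence mSt_relations"
      using mSt_complete[OF monoid_congruence_generated[OF mSt_relations_words]
          generated_congruence_superset, of "[]" u v]
      by (simp add: uv same_first_order_def same_last_order_def)
  qed
  show "generated_congruence mSt_relations \<subseteq> meet_stalactic"
    unfolding meet_stalactic_def
    by (intro Int_greatest generated_congruence_least
        mSt_relations_subset_right_stalactic mSt_relations_subset_left_stalactic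
        monoid_congruence_right_stalactic monoid_congruence_left_stalactic)
qed

end
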